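(* Let $T:\ell^{1}(\mathbb{Z})\to\ell^{1}(\mathbb{Z})$ be a nonexpansive map, i.e. $\|Tx-Ty\|\leq\|x-y\|$ for all $x,y\in\ell^1(\mathbb{Z})$. Then there is a metric functional $h$ on $\ell^1(\mathbb{Z})$, not identically zero, such that $$h(Tx)\leq h(x)\quad\text{for every } x\in\ell^{1}(\mathbb{Z}),$$ and the orbit $(T^{n}0)_{n\geq 0}$ is contained in a half-space; more precisely, there is a continuous linear functional $f:\ell^1(\mathbb{Z})\to\mathbb{R}$, not identically zero, such that $$f(T^{n}0)\geq 0\quad\text{for all } n\geq 0.$$
   Context: Here $\ell^1(\mathbb{Z})$ is the real Banach space of absolutely summable real sequences indexed by $\mathbb{Z}$, with its usual norm $\|x\|=\sum_{s\in\mathbb{Z}}|x_s|$. Metric functionals: for a Banach space $X$, with base point $0$, define for each $x\in X$ the function $h_x:X\to\mathbb{R}$, $h_x(y)=\|y-x\|-\|x\|$, and let $\Phi:X\to\mathbb{R}^X$, $\Phi(x)=h_x$. Equip $\mathbb{R}^X$ with the topology of pointwise convergence. A metric functional on $X$ is an element of the closure $\overline{\Phi(X)}$ in $\mathbb{R}^X$ (this closure is compact). $T^n$ denotes the $n$-th iterate of $T$. *)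

theory Defs
  imports "HOL-Analysis.Analysis"
begin

typedef ell1_int = "{x :: int \<Rightarrow> real. (\<lambda>s. \<bar>x s\<bar>) summable_on UNIV}"
  morphisms ell1_nth Abs_ell1_int
  by (rule exI[of _ "\<lambda>_. 0"]) simp

setup_lifting type_definition_ell1_int

lemma ell1_add_summable:
  fixes x y :: "int \<Rightarrow> real"
  assumes "(\<lambda>s. \<bar>x s\<bar>) summable_on UNIV" "(\<lambda>s. \<bar>y s\<bar>) summable_on UNIV"
  shows "(\<lambda>s. \<bar>x s + y s\<bar>) summable_on UNIV"
  using summable_on_add[of x UNIV y] assms
  by (simp only: summable_on_iff_abs_summable_on_real[of _ UNIV, unfolded real_norm_def, symmetric])

lemma ell1_scale_summable:
  fixes x :: "int \<Rightarrow> real"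
  assumes "(\<lambda>s. \<bar>x s\<bar>) summable_on UNIV"
  shows "(\<lambda>s. \<bar>r * x s\<bar>) summable_on UNIV"
  using summable_on_cmult_right[OF assms, of "\<bar>r\<bar>"] by (simp add: abs_mult)

lemma ell1_diff_summable:
  fixes x y :: "int \<Rightarrow> real"
  assumes "(\<lambda>s. \<bar>x s\<bar>) summable_on UNIV" "(\<lambda>s. \<bar>y s\<bar>) summable_on UNIV"
  shows "(\<lambda>s. \<bar>x s - y s\<bar>) summable_on UNIV"
  using ell1_add_summable[OF assms(1) ell1_scale_summable[OF assms(2), of "-1"]] by simp

instantiation ell1_int :: real_normed_vector
begin

lift_definition zero_ell1_int :: ell1_int is "\<lambda>_. 0" by simp

lift_definition plus_ell1_int :: "ell1_int \<Rightarrow> ell1_int \<Rightarrow> ell1_int"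
  is "\<lambda>x y s. x s + y s" by (rule ell1_add_summable)

lift_definition minus_ell1_int :: "ell1_int \<Rightarrow> ell1_int \<Rightarrow> ell1_int"
  is "\<lambda>x y s. x s - y s" by (rule ell1_diff_summable)

lift_definition uminus_ell1_int :: "ell1_int \<Rightarrow> ell1_int"
  is "\<lambda>x s. - x s" by simp

lift_definition scaleR_ell1_int :: "real \<Rightarrow> ell1_int \<Rightarrow> ell1_int"
  is "\<lambda>r x s. r * x s" by (rule ell1_scale_summable)

lift_definition norm_ell1_int :: "ell1_int \<Rightarrow> real"
  is "\<lambda>x. \<Sum>\<^sub>\<infinity>s\<in>UNIV. \<bar>x s\<bar>" .

definition dist_ell1_int :: "ell1_int \<Rightarrow> ell1_int \<Rightarrow> real"
  where "dist_ell1_int x y = norm (x - y)"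

definition sgn_ell1_int :: "ell1_int \<Rightarrow> ell1_int"
  where "sgn_ell1_int x = scaleR (inverse (norm x)) x"

definition uniformity_ell1_int :: "(ell1_int \<times> ell1_int) filter"
  where "uniformity_ell1_int = (INF e\<in>{0<..}. principal {(x, y). dist x y < e})"

definition open_ell1_int :: "ell1_int set \<Rightarrow> bool"
  where "open_ell1_int S = (\<forall>x\<in>S. \<forall>\<^sub>F (x', y) in uniformity. x' = x \<longrightarrow> y \<in> S)"

instance
proof
  fix x y z :: ell1_int and a b :: real
  show "x + y + z = x + (y + z)" by transfer (simp add: add.assoc)
  show "x + y = y + x" by transfer (simp add: add.commute)
  show "0 + x = x" by transfer simp
  show "- x + x = 0" by transfer simp
  show "x - y = x + - y" by transfer simp
  show "a *\<^sub>R (x + y) = a *\<^sub>R x + a *\<^sub>R y" by transfer (simp add: distrib_left)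
  show "(a + b) *\<^sub>R x = a *\<^sub>R x + b *\<^sub>R x" by transfer (simp add: distrib_right)
  show "a *\<^sub>R b *\<^sub>R x = (a * b) *\<^sub>R x" by transfer (simp add: mult.assoc)
  show "1 *\<^sub>R x = x" by transfer simp
  show "dist x y = norm (x - y)" by (rule dist_ell1_int_def)
  show "sgn x = inverse (norm x) *\<^sub>R x" by (rule sgn_ell1_int_def)
  show "norm x = 0 \<longleftrightarrow> x = 0"
  proof (transfer, rule iffI)
    fix x :: "int \<Rightarrow> real"
    assume s: "(\<lambda>s. \<bar>x s\<bar>) summable_on UNIV" and z: "(\<Sum>\<^sub>\<infinity>s\<in>UNIV. \<bar>x s\<bar>) = 0"
    have "\<bar>x s\<bar> = 0" for s
      by (rule nonneg_infsum_le_0D[of "\<lambda>s. \<bar>x s\<bar>" UNIV]) (use s z in auto)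
    then show "x = (\<lambda>_. 0)" by auto
  qed simp
  show "norm (a *\<^sub>R x) = \<bar>a\<bar> * norm x"
    by transfer (simp add: abs_mult infsum_cmult_right')
  show "norm (x + y) \<le> norm x + norm y"
  proof transfer
    fix x y :: "int \<Rightarrow> real"
    assume s: "(\<lambda>s. \<bar>x s\<bar>) summable_on UNIV" "(\<lambda>s. \<bar>y s\<bar>) summable_on UNIV"
    have "(\<Sum>\<^sub>\<infinity>s\<in>UNIV. \<bar>x s + y s\<bar>) \<le> (\<Sum>\<^sub>\<infinity>s\<in>UNIV. \<bar>x s\<bar> + \<bar>y s\<bar>)"
      using s ell1_add_summable[OF s] by (intro infsum_mono summable_on_add) auto
    also have "\<dots> = (\<Sum>\<^sub>\<infinity>s\<in>UNIV. \<bar>x s\<bar>) + (\<Sum>\<^sub>\<infinity>s\<in>UNIV. \<bar>y s\<bar>)"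
      using s by (intro infsum_add) auto
    finally show "(\<Sum>\<^sub>\<infinity>s\<in>UNIV. \<bar>x s + y s\<bar>) \<le> (\<Sum>\<^sub>\<infinity>s\<in>UNIV. \<bar>x s\<bar>) + (\<Sum>\<^sub>\<infinity>s\<in>UNIV. \<bar>y s\<bar>)" .
  qed
qed (rule open_ell1_int_def uniformity_ell1_int_def)+

end

lemma ell1_sum_le_norm:
  assumes "finite F"
  shows "(\<Sum>s\<in>F. \<bar>ell1_nth x s\<bar>) \<le> norm x"
  using assms by transfer (rule finite_sum_le_infsum, auto)

instance ell1_int :: banach
proof
  fix X :: "nat \<Rightarrow> ell1_int"
  assume X: "Cauchy X"
  have sum_le: "(\<Sum>s\<in>F. \<bar>ell1_nth (X m) s - ell1_nth (X n) s\<bar>) \<le> norm (X m - X n)"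
    if "finite F" for F m n
    using ell1_sum_le_norm[OF that, of "X m - X n"] by (simp add: minus_ell1_int.rep_eq)
  have "Cauchy (\<lambda>n. ell1_nth (X n) s)" for s
  proof (rule CauchyI)
    fix e :: real assume "0 < e"
    then obtain M where M: "\<And>m n. m \<ge> M \<Longrightarrow> n \<ge> M \<Longrightarrow> norm (X m - X n) < e"
      using CauchyD[OF X] by blast
    have "norm (ell1_nth (X m) s - ell1_nth (X n) s) < e" if "m \<ge> M" "n \<ge> M" for m n
      using sum_le[of "{s}" m n] M[OF that] by simp
    then show "\<exists>M. \<forall>m\<ge>M. \<forall>n\<ge>M. norm (ell1_nth (X m) s - ell1_nth (X n) s) < e" by blast
  qed
  then have "\<exists>l. (\<lambda>n. ell1_nth (X n) s) \<longlonglongrightarrow> l" for s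
    using Cauchy_convergent convergent_def by blast
  then obtain l where l: "\<And>s. (\<lambda>n. ell1_nth (X n) s) \<longlonglongrightarrow> l s" by metis
  have key: "(\<Sum>s\<in>F. \<bar>ell1_nth (X m) s - l s\<bar>) \<le> e"
    if M: "\<And>m n. m \<ge> M \<Longrightarrow> n \<ge> M \<Longrightarrow> norm (X m - X n) < e" and "m \<ge> M" "finite F" for e M m F
  proof (rule LIMSEQ_le_const2)
    show "(\<lambda>n. \<Sum>s\<in>F. \<bar>ell1_nth (X m) s - ell1_nth (X n) s\<bar>)
        \<longlonglongrightarrow> (\<Sum>s\<in>F. \<bar>ell1_nth (X m) s - l s\<bar>)"
      by (intro tendsto_intros l)
    have "(\<Sum>s\<in>F. \<bar>ell1_nth (X m) s - ell1_nth (X n) s\<bar>) \<le> e" if "n \<ge> M" for n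
      using sum_le[OF \<open>finite F\<close>, of m n] M[OF \<open>m \<ge> M\<close> that] by simp
    then show "\<exists>N. \<forall>n\<ge>N. (\<Sum>s\<in>F. \<bar>ell1_nth (X m) s - ell1_nth (X n) s\<bar>) \<le> e" by blast
  qed
  have summ: "(\<lambda>s. \<bar>ell1_nth (X m) s - l s\<bar>) summable_on UNIV"
    if M: "\<And>m n. m \<ge> M \<Longrightarrow> n \<ge> M \<Longrightarrow> norm (X m - X n) < e" and "m \<ge> M" for e M m
    by (rule nonneg_bdd_above_summable_on)
       (use key[OF M \<open>m \<ge> M\<close>] in \<open>auto intro!: bdd_aboveI[where M = e]\<close>)
  obtain M0 where M0: "\<And>m n. m \<ge> M0 \<Longrightarrow> n \<ge> M0 \<Longrightarrow> norm (X m - X n) < 1"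
    using CauchyD[OF X zero_less_one] by blast
  have "(\<lambda>s. \<bar>ell1_nth (X M0) s - (ell1_nth (X M0) s - l s)\<bar>) summable_on UNIV"
    using ell1_nth[of "X M0"] by (intro ell1_diff_summable summ[OF M0]) auto
  then have lsumm: "(\<lambda>s. \<bar>l s\<bar>) summable_on UNIV" by simp
  define L where "L = Abs_ell1_int l"
  have L: "ell1_nth L = l" using lsumm by (simp add: L_def Abs_ell1_int_inverse)
  have "X \<longlonglongrightarrow> L"
  proof (rule LIMSEQ_I)
    fix e :: real assume "0 < e"
    then obtain M where M: "\<And>m n. m \<ge> M \<Longrightarrow> n \<ge> M \<Longrightarrow> norm (X m - X n) < e / 2"
      using CauchyD[OF X, of "e / 2"] by auto
    have "norm (X m - L) < e" if "m \<ge> M" for m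
    proof -
      have "norm (X m - L) = (\<Sum>\<^sub>\<infinity>s\<in>UNIV. \<bar>ell1_nth (X m) s - l s\<bar>)"
        by (simp add: norm_ell1_int.rep_eq minus_ell1_int.rep_eq L)
      also have "\<dots> \<le> e / 2"
        using summ[OF M that] key[OF M that] by (intro infsum_le_finite_sums) auto
      finally show ?thesis using \<open>0 < e\<close> by simp
    qed
    then show "\<exists>no. \<forall>n\<ge>no. norm (X n - L) < e" by blast
  qed
  then show "convergent X" by (auto simp: convergent_def)
qed

definition internal_metric_functional :: "'a::banach \<Rightarrow> 'a \<Rightarrow> real"
  where "internal_metric_functional x = (\<lambda>y. norm (y - x) - norm x)"

text \<open>The library topology on a function type is the product topology, i.e. that of
  pointwise convergence.\<close>

definition metric_functionals :: "('a::banach \<Rightarrow> real) set"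
  where "metric_functionals = closure (range internal_metric_functional)"

end

theory Submission
  imports Defs
begin

text \<open>
  Scaling \<open>T\<close> by a factor \<open>r < 1\<close> gives a contraction, which has a fixed point \<open>x = r T x\<close>.
  Measured from this fixed point, \<open>T\<close> increases distances by at most an error that vanishes as
  \<open>r\<close> tends to \<open>1\<close>: \<open>h\<^sub>x (T y) \<le> h\<^sub>x y + (1 - r) \<parallel>T y\<parallel>\<close>
  (lemma \<open>approx_invariant_internal_metric_functional\<close>).
  A pointwise cluster point \<open>h\<close> of the functions \<open>h\<^sub>x\<close> as \<open>r\<close> tends to \<open>1\<close> exists by Tychonoff's
  theorem, because \<open>\<bar>h\<^sub>x y\<bar> \<le> \<parallel>y\<parallel>\<close>, and it satisfies \<open>h (T y) \<le> h y\<close> exactly.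

  In a general Banach space such a limit may vanish identically. In \<open>\<ell>\<^sup>1\<close> it cannot, and the same
  observation produces the half-space. The convex function \<open>h\<^sub>x\<close> vanishes at \<open>0\<close>, and as a
  subgradient there one can always take a functional \<open>g\<^sub>x y = (\<Sum>s. \<sigma>\<^sub>s y\<^sub>s)\<close>
  in which \<^emph>\<open>every\<close> coefficient is \<open>1\<close> or \<open>-1\<close>
  (lemma \<open>ell1_linear_minorant\<close>). Its value on a unit vector has absolute value \<open>1\<close>, a closed
  condition, so it survives in the limit. Passing to the limit with the pairs \<open>(h\<^sub>x, g\<^sub>x)\<close>
  simultaneously yields \<open>h\<close> together with a nonzero continuous linear functional \<open>g \<le> h\<close>. Hence
  \<open>h\<close> is not zero, and \<open>g (T\<^sup>n 0) \<le> h (T\<^sup>n 0) \<le> h 0 = 0\<close>, so \<open>-g\<close> is nonnegative on the orbit.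
\<close>

section \<open>Pointwise limits of bounded sequences of functions\<close>

lemma tendsto_fun_iff:
  fixes u :: "'n \<Rightarrow> 'i \<Rightarrow> 'b::topological_space"
  shows "(u \<longlongrightarrow> l) G \<longleftrightarrow> (\<forall>i. ((\<lambda>n. u n i) \<longlongrightarrow> l i) G)"
proof -
  have "limitin (product_topology (\<lambda>_::'i. euclidean) UNIV) u l G
      \<longleftrightarrow> (\<forall>i. ((\<lambda>n. u n i) \<longlongrightarrow> l i) G)"
    unfolding limitin_componentwise by (auto simp: extensional_def)
  then show ?thesis by (simp add: euclidean_product_topology)
qed

text \<open>The index set \<open>'i\<close> may be uncountable, so a subsequence need not suffice; a finer filter
  plays the role of a subnet.\<close>

lemma pointwise_bounded_convergent_subfilter:
  fixes u :: "nat \<Rightarrow> 'i \<Rightarrow> real"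
  assumes bound: "\<And>n i. \<bar>u n i\<bar> \<le> B i"
  obtains G l where "G \<le> sequentially" "G \<noteq> bot" "\<And>i. ((\<lambda>n. u n i) \<longlongrightarrow> l i) G"
proof -
  let ?K = "PiE UNIV (\<lambda>i. {- B i .. B i})"
  have "compactin (product_topology (\<lambda>_::'i. euclidean) UNIV) ?K"
    by (simp add: compactin_PiE)
  then have K: "compact ?K"
    by (simp add: euclidean_product_topology)
  have "u n \<in> ?K" for n
    using bound[of n] by (simp add: PiE_iff abs_le_iff) (metis minus_le_iff)
  then have "\<forall>\<^sub>F f in filtermap u sequentially. f \<in> ?K"
    by (simp add: eventually_filtermap)
  moreover have "filtermap u sequentially \<noteq> bot"
    by (simp add: filtermap_bot_iff)
  ultimately obtain l where l: "inf (nhds l) (filtermap u sequentially) \<noteq> bot"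
    using K unfolding compact_filter by blast
  define G where "G = inf sequentially (filtercomap u (nhds l))"
  have "G \<noteq> bot"
  proof
    assume "G = bot"
    then obtain P Q where P: "eventually P sequentially" and Q: "eventually Q (nhds l)"
      and PQ: "\<And>n. P n \<Longrightarrow> Q (u n) \<Longrightarrow> False"
      unfolding G_def trivial_limit_def eventually_inf eventually_filtercomap by blast
    have "\<forall>\<^sub>F n in sequentially. \<not> Q (u n)"
      using P by (rule eventually_mono) (use PQ in blast)
    then have "eventually (\<lambda>f. \<not> Q f) (filtermap u sequentially)"
      by (simp add: eventually_filtermap)
    with Q have "eventually (\<lambda>_. False) (inf (nhds l) (filtermap u sequentially))"
      unfolding eventually_inf by blast
    with l show False by (simp add: trivial_limit_def)
  qed
  moreover have "((\<lambda>n. u n i) \<longlongrightarrow> l i) G" for i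
  proof -
    have "(u \<longlongrightarrow> l) G"
      unfolding filterlim_iff_le_filtercomap G_def by simp
    then show ?thesis by (simp add: tendsto_fun_iff)
  qed
  moreover have "G \<le> sequentially" by (simp add: G_def)
  ultimately show ?thesis using that by blast
qed

section \<open>Metric functionals decreasing along a nonexpansive map\<close>

lemma internal_metric_functional_abs_le: "\<bar>internal_metric_functional x y\<bar> \<le> norm y"
  unfolding internal_metric_functional_def
  using norm_triangle_ineq4[of y x] norm_triangle_ineq3[of "y - x" "- x"] by simp

text \<open>The base point is the fixed point of the contraction \<open>(1 - e) T\<close>.\<close>

lemma approx_invariant_internal_metric_functional:
  fixes T :: "'a::banach \<Rightarrow> 'a"
  assumes nonexpansive: "\<And>x y. norm (T x - T y) \<le> norm (x - y)" and e: "0 < e" "e \<le> 1"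
  obtains x where
    "\<And>y. internal_metric_functional x (T y) \<le> internal_metric_functional x y + e * norm (T y)"
proof -
  have "dist ((1 - e) *\<^sub>R T x) ((1 - e) *\<^sub>R T y) \<le> (1 - e) * dist x y" for x y
    using e nonexpansive[of x y]
    by (simp add: dist_norm mult_left_mono flip: scaleR_diff_right)
  then obtain x where x: "(1 - e) *\<^sub>R T x = x"
    using banach_fix_type[of "1 - e" "\<lambda>x. (1 - e) *\<^sub>R T x"] e by auto
  have "norm (T y - x) \<le> norm (y - x) + e * norm (T y)" for y
  proof -
    have "T y - x = (1 - e) *\<^sub>R (T y - T x) + e *\<^sub>R T y"
      using x by (simp add: algebra_simps)
    then have "norm (T y - x) \<le> (1 - e) * norm (T y - T x) + e * norm (T y)"
      using norm_triangle_ineq[of "(1 - e) *\<^sub>R (T y - T x)" "e *\<^sub>R T y"] e by simp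
    also have "(1 - e) * norm (T y - T x) \<le> 1 * norm (y - x)"
      using e nonexpansive[of y x] by (intro mult_mono) auto
    finally show ?thesis by simp
  qed
  then show ?thesis
    using that[of x] by (simp add: internal_metric_functional_def)
qed

text \<open>The vector \<open>v\<close> detects that the linear minorants of the functions \<open>h\<^sub>x\<close> stay away from zero
  uniformly in \<open>x\<close>; this keeps the limits from vanishing.\<close>

lemma nonexpansive_metric_functional_with_linear_minorant:
  fixes T :: "'a::banach \<Rightarrow> 'a"
  assumes nonexpansive: "\<And>x y. norm (T x - T y) \<le> norm (x - y)"
    and minorant: "\<And>x. \<exists>g. linear g \<and> (\<forall>y. \<bar>g y\<bar> \<le> norm y) \<and>
      (\<forall>y. g y \<le> internal_metric_functional x y) \<and> \<bar>g v\<bar> = 1"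
  obtains h g where "h \<in> metric_functionals" "\<And>x. h (T x) \<le> h x" "h 0 = 0"
    "bounded_linear g" "\<And>y. g y \<le> h y" "\<bar>g v\<bar> = 1"
proof -
  define e where "e n = inverse (real (Suc n))" for n
  have e: "0 < e n" "e n \<le> 1" for n
    by (simp_all add: e_def field_simps)
  have e_lim: "e \<longlonglongrightarrow> 0"
    unfolding e_def by (rule LIMSEQ_inverse_real_of_nat)
  have "\<forall>n. \<exists>x. \<forall>y. internal_metric_functional x (T y)
      \<le> internal_metric_functional x y + e n * norm (T y)"
    using approx_invariant_internal_metric_functional[OF nonexpansive e] by metis
  then obtain x where x: "\<And>n y. internal_metric_functional (x n) (T y)
      \<le> internal_metric_functional (x n) y + e n * norm (T y)"
    by metis
  obtain \<gamma> where \<gamma>: "\<And>n. linear (\<gamma> n)" "\<And>n y. \<bar>\<gamma> n y\<bar> \<le> norm y"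
      "\<And>n y. \<gamma> n y \<le> internal_metric_functional (x n) y" "\<And>n. \<bar>\<gamma> n v\<bar> = 1"
    using minorant[of "x _"] by metis
  \<comment> \<open>Indexing both families by one disjoint union makes them converge along a common filter.\<close>
  define u where
    "u n = case_sum (internal_metric_functional (x n)) (\<gamma> n)" for n
  have bound: "\<bar>u n i\<bar> \<le> case_sum norm norm i" for n i
    by (cases i) (simp_all add: u_def internal_metric_functional_abs_le \<gamma>)
  obtain G l where G: "G \<le> sequentially" "G \<noteq> bot"
      and l: "\<And>i. ((\<lambda>n. u n i) \<longlongrightarrow> l i) G"
    by (rule pointwise_bounded_convergent_subfilter[of u, OF bound]) blast
  define h g where "h y = l (Inl y)" and "g y = l (Inr y)" for y
  have h: "((\<lambda>n. internal_metric_functional (x n) y) \<longlongrightarrow> h y) G" for y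
    using l[of "Inl y"] by (simp add: u_def h_def)
  have g: "((\<lambda>n. \<gamma> n y) \<longlongrightarrow> g y) G" for y
    using l[of "Inr y"] by (simp add: u_def g_def)
  have e_G: "(e \<longlongrightarrow> 0) G"
    using e_lim G(1) by (rule tendsto_mono[rotated])
  have "h \<in> metric_functionals"
    unfolding metric_functionals_def
  proof (rule Lim_in_closed_set[OF closed_closure _ G(2)])
    show "\<forall>\<^sub>F n in G. internal_metric_functional (x n) \<in> closure (range internal_metric_functional)"
      by (intro always_eventually allI) (meson closure_subset rangeI subsetD)
    show "((\<lambda>n. internal_metric_functional (x n)) \<longlongrightarrow> h) G"
      using h by (simp add: tendsto_fun_iff)
  qed
  moreover have "h (T y) \<le> h y" for y
  proof -
    have "((\<lambda>n. internal_metric_functional (x n) y + e n * norm (T y)) \<longlongrightarrow> h y + 0 * norm (T y)) G"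
      by (intro tendsto_intros h e_G)
    from tendsto_le[OF G(2) this h] x show ?thesis by simp
  qed
  moreover have "h 0 = 0"
    using tendsto_unique[OF G(2) h[of 0]] tendsto_const[of 0 G]
    by (simp add: internal_metric_functional_def)
  moreover have "bounded_linear g"
  proof (rule bounded_linear_intro[where K = 1])
    show "g (a + b) = g a + g b" for a b
      using tendsto_unique[OF G(2) g[of "a + b"]] tendsto_add[OF g[of a] g[of b]]
      by (simp add: linear_add[OF \<gamma>(1)])
    show "g (r *\<^sub>R a) = r *\<^sub>R g a" for r a
      using tendsto_unique[OF G(2) g[of "r *\<^sub>R a"]] tendsto_scaleR[OF tendsto_const[of r] g[of a]]
      by (simp add: linear_scale[OF \<gamma>(1)])
    show "norm (g a) \<le> norm a * 1" for a
      using tendsto_upperbound[OF tendsto_rabs[OF g[of a]] _ G(2)] \<gamma>(2) by simp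
  qed
  moreover have "g y \<le> h y" for y
    using tendsto_le[OF G(2) h g] \<gamma>(3) by simp
  moreover have "\<bar>g v\<bar> = 1"
    using tendsto_unique[OF G(2) tendsto_rabs[OF g[of v]]] tendsto_const[of 1 G] \<gamma>(4) by simp
  ultimately show ?thesis using that by blast
qed

section \<open>Linear minorants in the space of summable sequences\<close>

lift_definition ell1_unit :: "int \<Rightarrow> ell1_int" is "\<lambda>t s. if s = t then 1 else 0"
proof -
  show "(\<lambda>s. \<bar>if s = t then 1 else 0 :: real\<bar>) summable_on UNIV" for t :: int
    by (rule finite_nonzero_values_imp_summable_on) simp
qed

lemma ell1_nth_abs_summable: "(\<lambda>s. \<bar>ell1_nth x s\<bar>) summable_on UNIV"
  using ell1_nth[of x] by simp

text \<open>In each coordinate, \<open>\<bar>b - a\<bar> - \<bar>a\<bar> \<ge> c b\<close> for all \<open>b\<close>, where \<open>c\<close> is the slope at \<open>0\<close> of the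
  left-hand side. At the kink \<open>a = 0\<close> every slope in \<open>[-1, 1]\<close> would do, and the choice \<open>c = 1\<close>
  keeps \<open>\<bar>c\<bar> = 1\<close> in all cases.\<close>

lemma ell1_linear_minorant:
  fixes x :: ell1_int
  shows "\<exists>g. linear g \<and> (\<forall>y. \<bar>g y\<bar> \<le> norm y) \<and>
    (\<forall>y. g y \<le> internal_metric_functional x y) \<and> (\<forall>t. \<bar>g (ell1_unit t)\<bar> = 1)"
proof -
  define c :: "int \<Rightarrow> real" where "c s = (if ell1_nth x s > 0 then -1 else 1)" for s
  define g where "g y = (\<Sum>\<^sub>\<infinity>s. c s * ell1_nth y s)" for y
  have abs_c: "\<bar>c s * b\<bar> = \<bar>b\<bar>" for s b
    by (simp add: c_def abs_mult)
  have abs_summable: "(\<lambda>s. norm (c s * ell1_nth y s)) summable_on UNIV" for y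
    using ell1_nth_abs_summable[of y] by (simp only: real_norm_def abs_c)
  then have summable: "(\<lambda>s. c s * ell1_nth y s) summable_on UNIV" for y
    by (rule abs_summable_summable)
  have "linear g"
  proof (rule linearI)
    show "g (a + b) = g a + g b" for a b
      using infsum_add[OF summable[of a] summable[of b]]
      by (simp add: g_def plus_ell1_int.rep_eq distrib_left)
    show "g (r *\<^sub>R a) = r *\<^sub>R g a" for r a
      by (simp add: g_def scaleR_ell1_int.rep_eq mult.left_commute[of _ r] infsum_cmult_right')
  qed
  moreover have "\<bar>g y\<bar> \<le> norm y" for y
    using norm_infsum_bound[OF abs_summable[of y]]
    by (simp add: g_def norm_ell1_int.rep_eq abs_c)
  moreover have "g y \<le> internal_metric_functional x y" for y
  proof -
    have "g y + norm x = (\<Sum>\<^sub>\<infinity>s. c s * ell1_nth y s + \<bar>ell1_nth x s\<bar>)"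
      using infsum_add[OF summable[of y] ell1_nth_abs_summable[of x]]
      by (simp add: g_def norm_ell1_int.rep_eq)
    also have "\<dots> \<le> (\<Sum>\<^sub>\<infinity>s. \<bar>ell1_nth (y - x) s\<bar>)"
      by (intro infsum_mono summable_on_add summable ell1_nth_abs_summable)
        (auto simp: c_def minus_ell1_int.rep_eq)
    finally show ?thesis
      by (simp add: internal_metric_functional_def norm_ell1_int.rep_eq)
  qed
  moreover have "\<bar>g (ell1_unit t)\<bar> = 1" for t
  proof -
    have "g (ell1_unit t) = (\<Sum>\<^sub>\<infinity>s\<in>{t}. c s * ell1_nth (ell1_unit t) s)"
      unfolding g_def by (rule infsum_cong_neutral) (auto simp: ell1_unit.rep_eq)
    then show ?thesis by (simp add: ell1_unit.rep_eq c_def)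
  qed
  ultimately show ?thesis by blast
qed

section \<open>The invariant metric functional and the half-space\<close>

theorem theorem4p1:
  fixes T :: "ell1_int \<Rightarrow> ell1_int"
  assumes nonexpansive: "\<forall>x y. norm (T x - T y) \<le> norm (x - y)"
  shows "(\<exists>h \<in> metric_functionals. h \<noteq> (\<lambda>_. 0) \<and> (\<forall>x. h (T x) \<le> h x)) \<and>
         (\<exists>f :: ell1_int \<Rightarrow> real. bounded_linear f \<and> f \<noteq> (\<lambda>_. 0) \<and> (\<forall>n. f ((T ^^ n) 0) \<ge> 0))"
proof -
  have T: "\<And>x y. norm (T x - T y) \<le> norm (x - y)"
    using nonexpansive by blast
  let ?v = "ell1_unit 0"
  have "\<exists>g. linear g \<and> (\<forall>y. \<bar>g y\<bar> \<le> norm y) \<and>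
      (\<forall>y. g y \<le> internal_metric_functional x y) \<and> \<bar>g ?v\<bar> = 1" for x
    using ell1_linear_minorant[of x] by blast
  then obtain h g where h: "h \<in> metric_functionals" "\<And>x. h (T x) \<le> h x" "h 0 = 0"
    and g: "bounded_linear g" "\<And>y. g y \<le> h y" "\<bar>g ?v\<bar> = 1"
    using nonexpansive_metric_functional_with_linear_minorant[OF T] by metis
  have "h \<noteq> (\<lambda>_. 0)"
  proof
    assume "h = (\<lambda>_. 0)"
    then have "g ?v \<le> 0" "g (- ?v) \<le> 0" using g(2) by metis+
    then show False
      using g(3) by (simp add: linear_neg[OF bounded_linear.linear[OF g(1)]])
  qed
  moreover have "h ((T ^^ n) 0) \<le> 0" for n
    by (induction n) (use h(2,3) order_trans in auto)
  then have "- g ((T ^^ n) 0) \<ge> 0" for n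
    using g(2) order_trans by fastforce
  moreover have "bounded_linear (\<lambda>y. - g y)"
    using g(1) by (rule bounded_linear_minus)
  moreover have "(\<lambda>y. - g y) \<noteq> (\<lambda>_. 0)"
    using g(3) by (metis abs_zero neg_equal_0_iff_equal zero_neq_one)
  ultimately show ?thesis
    using h(1,2) by blast
qed

end
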